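(* Let $0<\alpha<2$, $0<\beta\le 1$, and let $B_{\alpha,\beta}=\{B_{\alpha,\beta}(t),\ t\ge 0\}$ be grey Brownian motion. Let $I\subset[0,1]$ be a Borel set. Then, almost surely, $B_{\alpha,\beta}$ admits a local time $L^{B_{\alpha,\beta}}(\cdot,I)$ over $I$ which is square integrable on $\mathbb{R}$ with respect to Lebesgue measure $\lambda$.
   Context: $E_\beta(x)=\sum_{n\ge0}x^n/\Gamma(\beta n+1)$ is the Mittag-Leffler function. Let $Y_\beta\ge 0$ be a random variable whose law (with density $M_\beta$, the M-Wright function; for $\beta=1$ the law is the point mass at $1$) is determined by $\mathbb{E}(e^{-sY_\beta})=E_\beta(-s)$, $s\ge0$. Let $B_H$ be a standard fractional Brownian motion with Hurst parameter $H=\alpha/2$ and continuous paths, i.e. the centered Gaussian process with covariance $\frac12(t^{\alpha}+s^{\alpha}-|t-s|^{\alpha})$, independent of $Y_\beta$. Grey Brownian motion is taken in the representation $B_{\alpha,\beta}(t)=\sqrt{Y_\beta}\,B_H(t)$, $t\ge0$; its increments have characteristic function $\mathbb{E}(e^{i\theta(B_{\alpha,\beta}(t)-B_{\alpha,\beta}(s))})=E_\beta(-\frac{\theta^2}{2}|t-s|^\alpha)$. For a measurable $f:I\to\mathbb{R}$ the occupation measure on $I$ is $\mu_f(B)=\int_I 1_B(f(s))\,ds$, $B\in\mathcal{B}(\mathbb{R})$. If $\mu_f$ is absolutely continuous with respect to $\lambda$, its density $L^f(\cdot,I)=d\mu_f/d\lambda$ is called the occupation density of $f$ over $I$. A continuous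 stochastic process $X$ admits a local time $L^X(\cdot,I)$ over $I$ if for almost every $\omega$ the path $X(\omega)$ has an occupation density over $I$, which is then denoted $L^X(\cdot,I)$. *)

theory Defs
  imports "HOL-Probability.Probability"
begin

definition mittag_leffler :: "real \<Rightarrow> real \<Rightarrow> real" where
  "mittag_leffler \<beta> x = (\<Sum>n. x ^ n / Gamma (\<beta> * real n + 1))"

text \<open>Normal law with mean \<open>m\<close> and standard deviation \<open>\<sigma>\<close>; the point mass at \<open>m\<close> counts as
  the normal law with \<open>\<sigma> = 0\<close>, since \<open>normal_density m 0\<close> does not describe it.\<close>

definition normal_law :: "real \<Rightarrow> real \<Rightarrow> real measure" where
  "normal_law m \<sigma> =
     (if \<sigma> = 0 then return borel m else density lborel (\<lambda>x. ennreal (normal_density m \<sigma> x)))"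

context prob_space
begin

definition gaussian_process :: "'t set \<Rightarrow> ('t \<Rightarrow> 'a \<Rightarrow> real) \<Rightarrow> bool" where
  "gaussian_process T X \<longleftrightarrow>
     (\<forall>t\<in>T. random_variable borel (X t)) \<and>
     (\<forall>F c. finite F \<longrightarrow> F \<subseteq> T \<longrightarrow>
        (\<exists>m \<sigma>. 0 \<le> \<sigma> \<and> distr M borel (\<lambda>\<omega>. \<Sum>t\<in>F. c t * X t \<omega>) = normal_law m \<sigma>))"

definition fractional_Brownian_motion :: "real \<Rightarrow> (real \<Rightarrow> 'a \<Rightarrow> real) \<Rightarrow> bool" where
  "fractional_Brownian_motion H B \<longleftrightarrow>
     gaussian_process {0..} B \<and>
     (\<forall>t\<ge>0. expectation (B t) = 0) \<and>
     (\<forall>s\<ge>0. \<forall>t\<ge>0. expectation (\<lambda>\<omega>. B s \<omega> * B t \<omega>) =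
        (t powr (2 * H) + s powr (2 * H) - \<bar>t - s\<bar> powr (2 * H)) / 2) \<and>
     (\<forall>\<omega>\<in>space M. continuous_on {0..} (\<lambda>t. B t \<omega>))"

text \<open>The law of a nonnegative random variable is determined by its Laplace transform, so the
  following fixes the law of \<open>Y\<close> (the M-Wright law; the point mass at 1 for \<open>\<beta> = 1\<close>).\<close>

definition M_Wright_variable :: "real \<Rightarrow> ('a \<Rightarrow> real) \<Rightarrow> bool" where
  "M_Wright_variable \<beta> Y \<longleftrightarrow>
     random_variable borel Y \<and> (AE \<omega> in M. 0 \<le> Y \<omega>) \<and>
     (\<forall>s\<ge>0. expectation (\<lambda>\<omega>. exp (- s * Y \<omega>)) = mittag_leffler \<beta> (- s))"

text \<open>Independence of \<open>Y\<close> and the whole process \<open>B\<close>, viewed as a random element of the product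
  space over the time set, is stated for the generated sigma-algebras: \<open>indep_var\<close> would force
  both random elements to have the same type.\<close>

definition grey_Brownian_motion :: "real \<Rightarrow> real \<Rightarrow> (real \<Rightarrow> 'a \<Rightarrow> real) \<Rightarrow> bool" where
  "grey_Brownian_motion \<alpha> \<beta> X \<longleftrightarrow>
     (\<exists>Y B. M_Wright_variable \<beta> Y \<and>
        fractional_Brownian_motion (\<alpha> / 2) B \<and>
        indep_set
          (sets (vimage_algebra (space M) Y borel))
          (sets (vimage_algebra (space M) (\<lambda>\<omega>. \<lambda>t\<in>{0..}. B t \<omega>) (PiM {0..} (\<lambda>_. borel)))) \<and>
        (\<forall>t\<ge>0. \<forall>\<omega>\<in>space M. X t \<omega> = sqrt (Y \<omega>) * B t \<omega>))"

end

definition occupation_measure :: "(real \<Rightarrow> real) \<Rightarrow> real set \<Rightarrow> real measure" where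
  "occupation_measure f I = distr (restrict_space lborel I) borel f"

text \<open>Measurability of \<open>f\<close> on \<open>I\<close> is demanded explicitly: without it \<open>occupation_measure f I\<close>
  could be a junk value.\<close>

definition has_occupation_density :: "(real \<Rightarrow> real) \<Rightarrow> real set \<Rightarrow> bool" where
  "has_occupation_density f I \<longleftrightarrow>
     f \<in> borel_measurable (restrict_space lborel I) \<and>
     absolutely_continuous lborel (occupation_measure f I)"

definition occupation_density :: "(real \<Rightarrow> real) \<Rightarrow> real set \<Rightarrow> real \<Rightarrow> ennreal" where
  "occupation_density f I = RN_deriv lborel (occupation_measure f I)"

definition admits_local_time :: "'a measure \<Rightarrow> (real \<Rightarrow> 'a \<Rightarrow> real) \<Rightarrow> real set \<Rightarrow> bool" where
  "admits_local_time M X I \<longleftrightarrow> (AE \<omega> in M. has_occupation_density (\<lambda>t. X t \<omega>) I)"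

definition local_time :: "(real \<Rightarrow> 'a \<Rightarrow> real) \<Rightarrow> real set \<Rightarrow> 'a \<Rightarrow> real \<Rightarrow> ennreal" where
  "local_time X I \<omega> = occupation_density (\<lambda>t. X t \<omega>) I"

end

(* A grey Brownian path is a positive multiple of a path of B, so it suffices to know that Y > 0
   almost surely and that fractional Brownian motion has square integrable occupation densities.

   Positivity of Y: the Mittag-Leffler function satisfies the renewal equation
     1 - E(-x) = x / Gamma(b) * integral over [0,1] of (1 - u)^(b - 1) E(-x u^b) du.
   If c = P(Y = 0), then E(-s) >= c for all s >= 0, so the equation gives 1 >= x c / Gamma(b + 1) for
   every x > 0, whence c = 0.

   Occupation densities: call the mu x mu measure of the pairs at distance less than 2r, divided by
   2r, the energy of mu at scale r.  A finite measure whose energies stay bounded along a sequence of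
   scales tending to 0 has an L^2 density, because its mollifications are bounded in L^2.  For the
   occupation measure of B the expected energy at every scale is at most a constant times the double
   integral of |s - t|^(-H), which is finite as H = alpha / 2 < 1, and Fatou's lemma yields almost
   surely a sequence of scales with bounded energies. *)

theory Submission
  imports Defs
begin

section \<open>Mittag-Leffler series, their renewal equation, and the absence of an atom of
  \<open>Y\<close> at 0\<close>

section \<open>Positivity of the M-Wright variable\<close>

text \<open>In the integral for \<open>Gamma (y + 1)\<close>, keep only the part over
  \<open>{K..}\<close> and bound \<open>t powr y\<close> below by \<open>K powr y\<close> there. As
  \<open>K\<close> is free, \<open>Gamma (\<beta> * n + 1)\<close> outgrows every geometric sequence
  in \<open>n\<close>.\<close>

lemma Gamma_ge_powr:
  fixes K y :: real
  assumes "0 < K" "0 \<le> y"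
  shows "K powr y * exp (- K) \<le> Gamma (y + 1)"
proof -
  have "((\<lambda>t. exp (- 1 * t)) has_integral exp (- 1 * K) / 1) {K..}"
    by (rule has_integral_exp_minus_to_infinity) simp
  from has_integral_mult_right[OF this, of "K powr y"]
  have "((\<lambda>t. K powr y * exp (- t)) has_integral K powr y * exp (- K)) {K..}"
    by simp
  then have 1: "((\<lambda>t. if t \<in> {K..} then K powr y * exp (- t) else 0) has_integral K powr y * exp (- K)) {0..}"
    by (subst has_integral_restrict) (use assms in auto)
  have 2: "((\<lambda>t. t powr y / exp t) has_integral Gamma (y + 1)) {0..}"
    using Gamma_integral_real[of "y + 1"] assms by simp
  show ?thesis
    by (rule has_integral_le[OF 1 2])
       (use assms in \<open>auto simp: exp_minus field_simps intro!: powr_mono2\<close>)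
qed

lemma summable_mittag_leffler:
  fixes \<beta> x :: real
  assumes "0 < \<beta>"
  shows "summable (\<lambda>n. x ^ n / Gamma (\<beta> * real n + 1))"
proof (rule summable_comparison_test')
  \<comment> \<open>With this \<open>K\<close> the Gamma factor is at least a constant times
    \<open>(2 * \<bar>x\<bar> + 1) ^ n\<close>, so the terms decay with a ratio below 1/2. The
    summand 1 keeps \<open>K\<close> positive at \<open>x = 0\<close>.\<close>
  define K where "K = (2 * \<bar>x\<bar> + 1) powr (1 / \<beta>)"
  have K: "0 < K" "K powr \<beta> = 2 * \<bar>x\<bar> + 1"
    using assms by (auto simp: K_def powr_powr)
  show "summable (\<lambda>n. exp K * (\<bar>x\<bar> / (2 * \<bar>x\<bar> + 1)) ^ n)"
    by (intro summable_mult summable_geometric) (simp add: field_simps)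
  fix n :: nat
  have "(2 * \<bar>x\<bar> + 1) ^ n * exp (- K) \<le> Gamma (\<beta> * real n + 1)"
    using Gamma_ge_powr[of K "\<beta> * real n"] K assms
    by (simp add: powr_powr[symmetric] powr_realpow)
  moreover have "0 < (2 * \<bar>x\<bar> + 1) ^ n * exp (- K)" by simp
  ultimately have "\<bar>x\<bar> ^ n / Gamma (\<beta> * real n + 1) \<le> \<bar>x\<bar> ^ n / ((2 * \<bar>x\<bar> + 1) ^ n * exp (- K))"
    by (intro divide_left_mono mult_pos_pos) (use assms in \<open>auto intro!: Gamma_real_pos add_nonneg_pos\<close>)
  also have "\<dots> = exp K * (\<bar>x\<bar> / (2 * \<bar>x\<bar> + 1)) ^ n"
    by (simp add: exp_minus power_divide field_simps)
  finally show "norm (x ^ n / Gamma (\<beta> * real n + 1)) \<le> exp K * (\<bar>x\<bar> / (2 * \<bar>x\<bar> + 1)) ^ n"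
    using assms by (simp add: power_abs abs_of_pos[OF Gamma_real_pos] add_nonneg_pos)
qed

text \<open>The renewal equation comes from termwise integration: the Beta integral turns the
  coefficient \<open>1 / Gamma (\<beta> * n + 1)\<close> into
  \<open>1 / Gamma (\<beta> * (n + 1) + 1)\<close>, which shifts the series by one index. Bounding
  the Mittag-Leffler function below by \<open>c\<close> under the integral leaves
  \<open>x * c / Gamma \<beta> * Beta 1 \<beta>\<close>, the left-hand side.\<close>

lemma mittag_leffler_lower_bound:
  fixes \<beta> c x :: real
  assumes "0 < \<beta>" "0 < x" and c: "\<And>s. 0 \<le> s \<Longrightarrow> c \<le> mittag_leffler \<beta> (- s)"
  shows "x * c / Gamma (\<beta> + 1) \<le> 1 - mittag_leffler \<beta> (- x)"
proof -
  \<comment> \<open>\<open>b n\<close> is the integrand of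
    \<open>Beta (\<beta> * n + 1) \<beta>\<close>, and \<open>k n\<close> is the coefficient in
    front of it. Their integrals \<open>v n\<close> are the terms of the series for
    \<open>1 - mittag_leffler \<beta> (- x)\<close>, whose constant term has cancelled.\<close>
  define b :: "nat \<Rightarrow> real \<Rightarrow> real"
    where "b n u = indicator {0..1} u * (u powr (\<beta> * n) * (1 - u) powr (\<beta> - 1))" for n u
  define k :: "nat \<Rightarrow> real" where "k n = x / Gamma \<beta> * ((- x) ^ n / Gamma (\<beta> * n + 1))" for n
  define v :: "nat \<Rightarrow> real" where "v n = x * ((- x) ^ n / Gamma (\<beta> * n + 1 + \<beta>))" for n
  have G: "Gamma y > 0" if "y > 0" for y :: real using that by (rule Gamma_real_pos)
  have Gb: "Gamma (\<beta> * n + 1) > 0" "Gamma (\<beta> * n + 1 + \<beta>) > 0" "Gamma \<beta> > 0" for n :: nat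
    using assms(1) by (intro G; simp add: add_nonneg_pos add_pos_nonneg)+
  have b: "has_bochner_integral lborel (b n) (Beta (\<beta> * n + 1) \<beta>)" for n
  proof -
    have p: "\<beta> * n + 1 > 0" using assms(1) by (simp add: add_nonneg_pos)
    have I: "set_integrable lborel {0..1} (\<lambda>u. u powr (\<beta> * n) * (1 - u) powr (\<beta> - 1))"
      using integrable_Beta[OF p assms(1)] by simp
    have "(LINT u:{0..1}|lborel. u powr (\<beta> * n) * (1 - u) powr (\<beta> - 1)) = Beta (\<beta> * n + 1) \<beta>"
      using set_borel_integral_eq_integral(2)[OF I] has_integral_Beta_real[OF p assms(1)]
      by (simp add: integral_unique)
    with I show ?thesis
      unfolding has_bochner_integral_iff set_integrable_def set_lebesgue_integral_def b_def
      by (auto simp: mult.commute)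
  qed
  have b_pos: "b n u \<ge> 0" for n u by (simp add: b_def)
  have v: "k n * Beta (\<beta> * n + 1) \<beta> = v n" for n
    using Gb(1)[of n] Gb(2)[of n] Gb(3) by (simp add: k_def v_def Beta_def field_simps)
  have sv: "summable (\<lambda>n. \<bar>v n\<bar>)" and vs: "suminf v = 1 - mittag_leffler \<beta> (- x)"
  proof -
    have s: "summable (\<lambda>n. y ^ Suc n / Gamma (\<beta> * real (Suc n) + 1))" for y
      using summable_mittag_leffler[OF assms(1), of y] by (subst summable_Suc_iff)
    have ve: "v n = - ((- x) ^ Suc n / Gamma (\<beta> * real (Suc n) + 1))" for n
      by (simp add: v_def algebra_simps)
    have va: "\<bar>v n\<bar> = x ^ Suc n / Gamma (\<beta> * real (Suc n) + 1)" for n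
      using Gb(2)[of n] assms(2) by (simp add: v_def abs_mult power_abs algebra_simps)
    show "summable (\<lambda>n. \<bar>v n\<bar>)" unfolding va by (rule s)
    have "suminf v = - (\<Sum>n. (- x) ^ Suc n / Gamma (\<beta> * real (Suc n) + 1))"
      unfolding ve by (rule suminf_minus[OF s])
    also have "\<dots> = 1 - mittag_leffler \<beta> (- x)"
      using suminf_split_head[OF summable_mittag_leffler[OF assms(1), of "- x"]]
      by (simp add: mittag_leffler_def)
    finally show "suminf v = 1 - mittag_leffler \<beta> (- x)" .
  qed
  have ser: "(\<lambda>n. k n * b n u) sums (x / Gamma \<beta> * b 0 u * mittag_leffler \<beta> (- (x * u powr \<beta>)))" for u
  proof (cases "0 < u \<and> u < 1")
    case True
    have "(- (x * u powr \<beta>)) ^ n = (- x * u powr \<beta>) ^ n" for n by simp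
    then have e: "(- (x * u powr \<beta>)) ^ n = (- x) ^ n * u powr (\<beta> * n)" for n
      using True by (simp only: power_mult_distrib) (simp add: powr_power mult.commute)
    have "(\<lambda>n. (- (x * u powr \<beta>)) ^ n / Gamma (\<beta> * real n + 1)) sums mittag_leffler \<beta> (- (x * u powr \<beta>))"
      using summable_mittag_leffler[OF assms(1)] by (simp add: mittag_leffler_def summable_sums)
    from sums_mult[OF this, of "x / Gamma \<beta> * b 0 u"] show ?thesis
      unfolding e
      using True by (simp add: b_def k_def mult_ac)
  next
    case False
    \<comment> \<open>At both endpoints every \<open>b n\<close> vanishes, since
      \<open>0 powr a = 0\<close> for all \<open>a\<close>; this includes \<open>b 0 0\<close>,
      where the exponent is 0. So both sides of the series identity are 0 there.\<close>
    then have "u = 0 \<or> b n u = 0" for n by (auto simp: b_def indicator_def)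
    then have "b n u = 0" for n by (auto simp: b_def)
    then show ?thesis by simp
  qed
  have int: "integrable lborel (\<lambda>u. k n * b n u)" for n
    using b[of n] by (auto simp: has_bochner_integral_iff)
  have intv: "(\<integral>u. k n * b n u \<partial>lborel) = v n" for n
    using b[of n] by (simp add: has_bochner_integral_iff v)
  \<comment> \<open>The weights are nonnegative, so taking norms only removes the signs from the
    terms. This gives the two kinds of absolute summability under which sum and integral may be
    exchanged.\<close>
  have nk: "norm (k n * b n u) = \<bar>k n\<bar> * b n u" for n u by (simp add: abs_mult b_pos)
  have "(\<integral>u. norm (k n * b n u) \<partial>lborel) = \<bar>v n\<bar>" for n
    unfolding nk v[symmetric] using b[of n] Gb(1)[of n] Gb(2)[of n] Gb(3)
    by (simp add: has_bochner_integral_iff abs_mult Beta_def)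
  then have sn: "summable (\<lambda>n. \<integral>u. norm (k n * b n u) \<partial>lborel)" using sv by simp
  have sb: "summable (\<lambda>n. norm (k n * b n u))" for u
  proof (cases "b 0 u = 0")
    case False
    then have u: "0 < u" "u < 1" by (auto simp: b_def indicator_def split: if_splits)
    have p: "(x * u powr \<beta>) ^ n = x ^ n * u powr (\<beta> * n)" for n
      using powr_power[where z = u and u = \<beta> and n = n] u by (simp only: power_mult_distrib) (simp add: mult.commute[of \<beta>])
    have a: "\<bar>k n\<bar> = x / Gamma \<beta> * (x ^ n / Gamma (\<beta> * n + 1))" for n
      using Gb(1)[of n] Gb(3) assms(2) by (simp add: k_def abs_mult power_abs)
    have e: "\<bar>k n\<bar> * b n u = x / Gamma \<beta> * b 0 u * ((x * u powr \<beta>) ^ n / Gamma (\<beta> * n + 1))" for n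
      using u unfolding p a by (simp add: b_def mult_ac)
    show ?thesis unfolding nk e using summable_mittag_leffler[OF assms(1)] by (rule summable_mult)
  next
    case True
    then have "b n u = 0" for n by (auto simp: b_def split: if_splits)
    then show ?thesis by simp
  qed
  have "x / Gamma \<beta> * c * Beta (\<beta> * real 0 + 1) \<beta> = (\<integral>u. x / Gamma \<beta> * c * b 0 u \<partial>lborel)"
    using b[of 0] by (simp add: has_bochner_integral_iff)
  also have "\<dots> \<le> (\<integral>u. (\<Sum>n. k n * b n u) \<partial>lborel)"
  proof (rule integral_mono)
    show "integrable lborel (\<lambda>u. x / Gamma \<beta> * c * b 0 u)" 
      using b[of 0] by (auto simp: has_bochner_integral_iff)
    show "integrable lborel (\<lambda>u. (\<Sum>n. k n * b n u))"
      using int sb sn by (intro integrable_suminf) auto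
    fix u :: real
    have "x / Gamma \<beta> * b 0 u * c \<le> x / Gamma \<beta> * b 0 u * mittag_leffler \<beta> (- (x * u powr \<beta>))"
      using c[of "x * u powr \<beta>"] assms(2) Gb(3) b_pos by (intro mult_left_mono) auto
    also have "\<dots> = (\<Sum>n. k n * b n u)" using ser by (rule sums_unique)
    finally show "x / Gamma \<beta> * c * b 0 u \<le> (\<Sum>n. k n * b n u)" by (simp add: mult_ac)
  qed
  also have "\<dots> = (\<Sum>n. \<integral>u. k n * b n u \<partial>lborel)"
    by (rule integral_suminf[OF int AE_I2[OF sb] sn])
  also have "\<dots> = 1 - mittag_leffler \<beta> (- x)" unfolding intv by (rule vs)
  finally show ?thesis using Gb(3) by (simp add: Beta_def add.commute)
qed

text \<open>On the event that \<open>Y\<close> is 0 the variable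
  \<open>exp (- s * Y \<omega>)\<close> equals 1, so the probability \<open>c\<close> of that event
  is a lower bound for the Laplace transform at every \<open>s\<close>.\<close>

lemma (in prob_space) M_Wright_variable_pos:
  assumes Y: "M_Wright_variable \<beta> Y" and "0 < \<beta>"
  shows "AE \<omega> in M. 0 < Y \<omega>"
proof -
  have [measurable]: "Y \<in> borel_measurable M" and nn: "AE \<omega> in M. 0 \<le> Y \<omega>"
    and L: "\<And>s. 0 \<le> s \<Longrightarrow> expectation (\<lambda>\<omega>. exp (- s * Y \<omega>)) = mittag_leffler \<beta> (- s)"
    using Y by (auto simp: M_Wright_variable_def)
  let ?A = "{\<omega>\<in>space M. Y \<omega> = 0}"
  have A[measurable]: "?A \<in> sets M" by measurable
  define c where "c = prob ?A"
  have le: "c \<le> mittag_leffler \<beta> (- s)" if "0 \<le> s" for s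
  proof -
    have "c = expectation (indicator ?A)" by (simp add: c_def)
    also have "\<dots> \<le> expectation (\<lambda>\<omega>. exp (- s * Y \<omega>))"
    proof (rule integral_mono_AE)
      show "integrable M (\<lambda>\<omega>. exp (- s * Y \<omega>))"
        using nn that by (intro integrable_const_bound[where B=1]) (auto intro!: mult_nonneg_nonneg)
    qed (use A in \<open>auto simp: indicator_def less_top[symmetric] intro!: integrable_real_indicator\<close>)
    finally show ?thesis using L[OF that] by simp
  qed
  have "c = 0"
  proof (rule ccontr)
    assume "c \<noteq> 0"
    then have c: "0 < c" by (simp add: c_def less_le)
    have G: "0 < Gamma (\<beta> + 1)" using assms(2) by (intro Gamma_real_pos) simp
    \<comment> \<open>Chosen to make the renewal lower bound equal to 2, whereas
      \<open>1 - mittag_leffler \<beta> (- x)\<close> is at most \<open>1 - c\<close>.\<close>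
    define x where "x = 2 * Gamma (\<beta> + 1) / c"
    have x: "0 < x" using c G by (simp add: x_def)
    have "x * c / Gamma (\<beta> + 1) \<le> 1 - mittag_leffler \<beta> (- x)"
      using assms(2) x le by (rule mittag_leffler_lower_bound)
    moreover have "x * c / Gamma (\<beta> + 1) = 2" using c G by (simp add: x_def)
    ultimately show False using le[of x] x c by simp
  qed
  then have "AE \<omega> in M. \<omega> \<notin> ?A"
    unfolding c_def using A by (simp add: prob_eq_0)
  with nn AE_space show ?thesis by eventually_elim auto
qed

section \<open>Mollification of a measure and the L^2 bound for its density\<close>

section \<open>Measures of bounded energy\<close>

text \<open>A linearised Cauchy-Schwarz inequality: integrated, it bounds a pairing by two squared
  L^2 norms without square roots, and it holds for infinite values too.\<close>

lemma ennreal_two_mult_le_squares: "2 * (a * b) \<le> a\<^sup>2 + (b :: ennreal)\<^sup>2"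
proof (cases "a = \<top> \<or> b = \<top>")
  case False
  then obtain x y where "0 \<le> x" "0 \<le> y" "a = ennreal x" "b = ennreal y"
    by (metis ennreal_cases)
  then show ?thesis
    using sum_squares_bound[of x y]
    by (simp add: ennreal_mult[symmetric] ennreal_plus[symmetric] power2_eq_square mult.assoc
        flip: ennreal_numeral del: ennreal_plus)
qed (auto simp: power2_eq_square ennreal_top_mult ennreal_mult_top)

lemma nn_integral_indicator_near:
  fixes x \<rho> :: real
  assumes "0 < \<rho>"
  shows "(\<integral>\<^sup>+ z. indicator {..<\<rho>} \<bar>x - z\<bar> \<partial>lborel) = ennreal (2 * \<rho>)"
proof -
  have "(\<integral>\<^sup>+ z. indicator {..<\<rho>} \<bar>x - z\<bar> \<partial>lborel) = (\<integral>\<^sup>+ z. indicator {x - \<rho><..<x + \<rho>} z \<partial>lborel)"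
    by (intro nn_integral_cong) (auto simp: indicator_def)
  then show ?thesis using assms by simp
qed

text \<open>The distance \<open>2 * r n\<close> is the one below which two balls of radius
  \<open>r n\<close> overlap. Only a sequence of scales is asked for, because Fatou's lemma provides
  no more for random paths.\<close>

locale bounded_energy = finite_measure \<mu> for \<mu> :: "real measure" +
  fixes r :: "nat \<Rightarrow> real" and C :: ennreal
  assumes sets_eq[measurable_cong, simp]: "sets \<mu> = sets borel"
    and r_pos: "\<And>n. 0 < r n" and r_lim: "r \<longlonglongrightarrow> 0"
    and energy: "\<And>n. (\<integral>\<^sup>+ x. \<integral>\<^sup>+ y. indicator {..<2 * r n} \<bar>x - y\<bar> \<partial>\<mu> \<partial>\<mu>) \<le> ennreal (2 * r n) * C"
    and C_finite: "C < \<infinity>"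
begin

sublocale pair_sigma_finite \<mu> lborel by standard

definition density_approx :: "nat \<Rightarrow> real \<Rightarrow> ennreal"
  where "density_approx n z = ennreal (1 / (2 * r n)) * (\<integral>\<^sup>+ x. indicator {..<r n} \<bar>x - z\<bar> \<partial>\<mu>)"

lemma density_approx_measurable[measurable]: "density_approx n \<in> borel_measurable borel"
  unfolding density_approx_def by measurable

text \<open>The square expands into a triple integral over two centres \<open>x\<close>,
  \<open>y\<close> and a point \<open>z\<close> in both balls. Integrating over \<open>z\<close>
  first gives the length of the overlap, at most \<open>2 * r n\<close>, and 0 unless the centres
  are closer than \<open>2 * r n\<close>. What remains is the energy, and the two normalising
  factors cancel.\<close>

lemma nn_integral_density_approx_square: "(\<integral>\<^sup>+ z. (density_approx n z)\<^sup>2 \<partial>lborel) \<le> C"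
proof -
  define w where "w = ennreal (1 / (2 * r n))"
  define J :: "real \<Rightarrow> real \<Rightarrow> ennreal" where "J x z = indicator {..<r n} \<bar>x - z\<bar>" for x z
  have [measurable]: "case_prod J \<in> borel_measurable (borel \<Otimes>\<^sub>M borel)"
    unfolding J_def by measurable
  have w: "w * ennreal (2 * r n) = 1"
    using r_pos[of n] by (simp add: w_def ennreal_mult[symmetric])
  have "(\<integral>\<^sup>+ z. (density_approx n z)\<^sup>2 \<partial>lborel) = (\<integral>\<^sup>+ z. w\<^sup>2 * (\<integral>\<^sup>+ x. \<integral>\<^sup>+ y. J x z * J y z \<partial>\<mu> \<partial>\<mu>) \<partial>lborel)"
    unfolding density_approx_def w_def[symmetric] J_def[symmetric]
    by (intro nn_integral_cong)
       (simp add: power2_eq_square nn_integral_cmult nn_integral_multc mult_ac)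
  also have "\<dots> = w\<^sup>2 * (\<integral>\<^sup>+ z. \<integral>\<^sup>+ x. \<integral>\<^sup>+ y. J x z * J y z \<partial>\<mu> \<partial>\<mu> \<partial>lborel)"
    by (rule nn_integral_cmult) measurable
  also have "(\<integral>\<^sup>+ z. \<integral>\<^sup>+ x. \<integral>\<^sup>+ y. J x z * J y z \<partial>\<mu> \<partial>\<mu> \<partial>lborel) =
      (\<integral>\<^sup>+ x. \<integral>\<^sup>+ z. \<integral>\<^sup>+ y. J x z * J y z \<partial>\<mu> \<partial>lborel \<partial>\<mu>)"
    by (rule Fubini') measurable
  also have "\<dots> = (\<integral>\<^sup>+ x. \<integral>\<^sup>+ y. \<integral>\<^sup>+ z. J x z * J y z \<partial>lborel \<partial>\<mu> \<partial>\<mu>)"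
    by (intro nn_integral_cong Fubini') measurable
  also have "\<dots> \<le> (\<integral>\<^sup>+ x. \<integral>\<^sup>+ y. ennreal (2 * r n) * indicator {..<2 * r n} \<bar>x - y\<bar> \<partial>\<mu> \<partial>\<mu>)"
  proof (intro nn_integral_mono)
    fix x y
    have "(\<integral>\<^sup>+ z. J x z * J y z \<partial>lborel) \<le> (\<integral>\<^sup>+ z. J x z * indicator {..<2 * r n} \<bar>x - y\<bar> \<partial>lborel)"
      by (intro nn_integral_mono) (auto simp: J_def indicator_def)
    also have "\<dots> = ennreal (2 * r n) * indicator {..<2 * r n} \<bar>x - y\<bar>"
      by (simp add: nn_integral_multc J_def nn_integral_indicator_near r_pos)
    finally show "(\<integral>\<^sup>+ z. J x z * J y z \<partial>lborel) \<le> ennreal (2 * r n) * indicator {..<2 * r n} \<bar>x - y\<bar>" .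
  qed
  also have "\<dots> = ennreal (2 * r n) * (\<integral>\<^sup>+ x. \<integral>\<^sup>+ y. indicator {..<2 * r n} \<bar>x - y\<bar> \<partial>\<mu> \<partial>\<mu>)"
    by (simp add: nn_integral_cmult)
  also have "\<dots> \<le> ennreal (2 * r n) * (ennreal (2 * r n) * C)"
    by (intro mult_left_mono energy) simp
  finally have "(\<integral>\<^sup>+ z. (density_approx n z)\<^sup>2 \<partial>lborel) \<le> w\<^sup>2 * (ennreal (2 * r n) * (ennreal (2 * r n) * C))"
    by (simp add: mult_left_mono)
  also have "\<dots> = (w * ennreal (2 * r n)) * (w * ennreal (2 * r n)) * C"
    by (simp add: power2_eq_square mult_ac)
  finally show ?thesis by (simp add: w)
qed

text \<open>Fatou's lemma applies because the averages of \<open>\<psi>\<close> over the balls of radius \<open>r n\<close> eventually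
  dominate \<open>\<psi>\<close> at each point; testing against such \<open>\<psi>\<close> (not just continuous ones) makes outer
  regularity applicable.\<close>

lemma nn_integral_locally_minorised_le:
  fixes \<psi> :: "real \<Rightarrow> ennreal"
  assumes [measurable]: "\<psi> \<in> borel_measurable borel"
    and loc: "\<And>x. eventually (\<lambda>z. \<psi> x \<le> \<psi> z) (nhds x)"
  shows "2 * (\<integral>\<^sup>+ x. \<psi> x \<partial>\<mu>) \<le> (\<integral>\<^sup>+ x. (\<psi> x)\<^sup>2 \<partial>lborel) + C"
proof -
  define w where "w n = ennreal (1 / (2 * r n))" for n
  define K where "K n x = w n * (\<integral>\<^sup>+ z. \<psi> z * indicator {..<r n} \<bar>x - z\<bar> \<partial>lborel)" for n x
  have [measurable]: "K n \<in> borel_measurable borel" for n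
    unfolding K_def by measurable
  have w: "w n * ennreal (2 * r n) = 1" for n
    using r_pos[of n] by (simp add: w_def ennreal_mult[symmetric])
  have dominate: "eventually (\<lambda>n. \<psi> x \<le> K n x) sequentially" for x
  proof -
    from loc[of x] obtain e where e: "0 < e" "\<And>z. dist z x < e \<Longrightarrow> \<psi> x \<le> \<psi> z"
      unfolding eventually_nhds_metric by auto
    have "eventually (\<lambda>n. r n < e) sequentially"
      using r_lim e(1) by (rule order_tendstoD)
    then show ?thesis
    proof eventually_elim
      case (elim n)
      have "\<psi> x = w n * (\<integral>\<^sup>+ z. \<psi> x * indicator {..<r n} \<bar>x - z\<bar> \<partial>lborel)"
        using w[of n] by (simp add: nn_integral_cmult nn_integral_indicator_near r_pos mult.left_commute)
      also have "\<dots> \<le> K n x"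
        unfolding K_def using elim e(2)
        by (intro mult_left_mono nn_integral_mono)
           (auto simp: indicator_def dist_real_def abs_minus_commute)
      finally show ?case .
    qed
  qed
  have K: "2 * (\<integral>\<^sup>+ x. K n x \<partial>\<mu>) \<le> (\<integral>\<^sup>+ x. (\<psi> x)\<^sup>2 \<partial>lborel) + C" for n
  proof -
    \<comment> \<open>The averaging kernel is symmetric, so Fubini moves it from \<psi> onto \<mu>,
      where it produces \<open>density_approx n\<close>.\<close>
    have "(\<integral>\<^sup>+ x. K n x \<partial>\<mu>) = w n * (\<integral>\<^sup>+ x. \<integral>\<^sup>+ z. \<psi> z * indicator {..<r n} \<bar>x - z\<bar> \<partial>lborel \<partial>\<mu>)"
      unfolding K_def by (rule nn_integral_cmult) measurable
    also have "(\<integral>\<^sup>+ x. \<integral>\<^sup>+ z. \<psi> z * indicator {..<r n} \<bar>x - z\<bar> \<partial>lborel \<partial>\<mu>) =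
        (\<integral>\<^sup>+ z. \<integral>\<^sup>+ x. \<psi> z * indicator {..<r n} \<bar>x - z\<bar> \<partial>\<mu> \<partial>lborel)"
      by (rule Fubini'[symmetric]) measurable
    also have "w n * \<dots> = (\<integral>\<^sup>+ z. w n * (\<integral>\<^sup>+ x. \<psi> z * indicator {..<r n} \<bar>x - z\<bar> \<partial>\<mu>) \<partial>lborel)"
      by (rule nn_integral_cmult[symmetric]) measurable
    also have "\<dots> = (\<integral>\<^sup>+ z. \<psi> z * density_approx n z \<partial>lborel)"
      by (intro nn_integral_cong) (simp add: density_approx_def w_def nn_integral_cmult mult_ac)
    finally have "2 * (\<integral>\<^sup>+ x. K n x \<partial>\<mu>) = (\<integral>\<^sup>+ z. 2 * (\<psi> z * density_approx n z) \<partial>lborel)"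
      by (simp add: nn_integral_cmult)
    also have "\<dots> \<le> (\<integral>\<^sup>+ z. (\<psi> z)\<^sup>2 + (density_approx n z)\<^sup>2 \<partial>lborel)"
      by (intro nn_integral_mono ennreal_two_mult_le_squares)
    also have "\<dots> = (\<integral>\<^sup>+ z. (\<psi> z)\<^sup>2 \<partial>lborel) + (\<integral>\<^sup>+ z. (density_approx n z)\<^sup>2 \<partial>lborel)"
      by (rule nn_integral_add) measurable
    also have "\<dots> \<le> (\<integral>\<^sup>+ z. (\<psi> z)\<^sup>2 \<partial>lborel) + C"
      by (intro add_left_mono nn_integral_density_approx_square)
    finally show ?thesis .
  qed
  have "2 * (\<integral>\<^sup>+ x. \<psi> x \<partial>\<mu>) = (\<integral>\<^sup>+ x. 2 * \<psi> x \<partial>\<mu>)"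
    by (simp add: nn_integral_cmult)
  also have "\<dots> \<le> (\<integral>\<^sup>+ x. liminf (\<lambda>n. 2 * K n x) \<partial>\<mu>)"
    by (intro nn_integral_mono Liminf_bounded eventually_mono[OF dominate] mult_left_mono) auto
  also have "\<dots> \<le> liminf (\<lambda>n. \<integral>\<^sup>+ x. 2 * K n x \<partial>\<mu>)"
    by (intro nn_integral_liminf) measurable
  also have "\<dots> \<le> liminf (\<lambda>n::nat. (\<integral>\<^sup>+ x. (\<psi> x)\<^sup>2 \<partial>lborel) + C)"
    using K by (intro Liminf_mono always_eventually allI) (simp add: nn_integral_cmult)
  finally show ?thesis by (simp add: Liminf_const)
qed

text \<open>A Lebesgue null set \<open>N\<close> has an open neighbourhood \<open>U\<close> of
  measure at most \<open>1 / k\<^sup>2\<close>. Testing with \<open>k\<close> times the indicator of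
  \<open>U\<close> gives \<open>2 * k * m \<le> 1 + c\<close>, where \<open>m\<close> is the
  \<mu>-measure of \<open>N\<close>; as \<open>k\<close> is arbitrary, \<open>m = 0\<close>.\<close>

lemma absolutely_continuous: "absolutely_continuous lborel \<mu>"
  unfolding absolutely_continuous_def
proof
  fix N :: "real set"
  assume N: "N \<in> null_sets lborel"
  then have [measurable]: "N \<in> sets borel" by auto
  obtain m where m: "emeasure \<mu> N = ennreal m" "0 \<le> m"
    using emeasure_finite[of N] by (cases "emeasure \<mu> N") auto
  obtain c where c: "C = ennreal c" "0 \<le> c"
    using C_finite by (cases C) auto
  have "2 * k * m \<le> 1 + c" if k: "0 < k" for k
  proof -
    obtain U where U: "open U" "N \<subseteq> U" "emeasure lborel (U - N) \<le> ennreal (1 / k\<^sup>2)"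
      using outer_regular_lborel_le[of N "1 / k\<^sup>2"] k by auto
    have [measurable]: "U \<in> sets borel" using U(1) by simp
    have eU: "emeasure lborel U \<le> ennreal (1 / k\<^sup>2)"
    proof -
      have "emeasure lborel U = emeasure lborel (U - N)"
        using N by (intro emeasure_Diff_null_set[symmetric]) auto
      with U(3) show ?thesis by simp
    qed
    define \<psi> :: "real \<Rightarrow> ennreal" where "\<psi> x = ennreal k * indicator U x" for x
    have loc: "eventually (\<lambda>z. \<psi> x \<le> \<psi> z) (nhds x)" for x
    proof (cases "x \<in> U")
      case True
      then have "eventually (\<lambda>z. z \<in> U) (nhds x)" using U(1) by (simp add: eventually_nhds_in_open)
      then show ?thesis by eventually_elim (simp add: \<psi>_def indicator_def)
    qed (simp add: \<psi>_def)
    have [measurable]: "\<psi> \<in> borel_measurable borel" unfolding \<psi>_def by measurable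
    have "ennreal (2 * k * m) = 2 * (ennreal k * emeasure \<mu> N)"
      using k m by (simp add: ennreal_mult mult.assoc)
    also have "\<dots> \<le> 2 * (ennreal k * emeasure \<mu> U)"
      using U(2) by (intro mult_left_mono emeasure_mono) auto
    also have "\<dots> = 2 * (\<integral>\<^sup>+ x. \<psi> x \<partial>\<mu>)"
      by (simp add: \<psi>_def nn_integral_cmult)
    also have "\<dots> \<le> (\<integral>\<^sup>+ x. (\<psi> x)\<^sup>2 \<partial>lborel) + C"
      using loc by (intro nn_integral_locally_minorised_le) auto
    also have "(\<integral>\<^sup>+ x. (\<psi> x)\<^sup>2 \<partial>lborel) = (\<integral>\<^sup>+ x. ennreal (k\<^sup>2) * indicator U x \<partial>lborel)"
      using k by (intro nn_integral_cong) (auto simp: \<psi>_def indicator_def ennreal_power)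
    also have "\<dots> = ennreal (k\<^sup>2) * emeasure lborel U"
      by (simp add: nn_integral_cmult)
    also have "\<dots> \<le> ennreal (k\<^sup>2) * ennreal (1 / k\<^sup>2)"
      by (intro mult_left_mono eU) simp
    also have "\<dots> = 1" using k by (simp add: ennreal_mult[symmetric])
    finally have "ennreal (2 * k * m) \<le> ennreal (1 + c)"
      using c by simp
    then show ?thesis using c by (subst (asm) ennreal_le_iff) auto
  qed
  note bound = this
  have "m = 0"
  proof (rule ccontr)
    assume "m \<noteq> 0"
    then have "0 < m" using m by simp
    \<comment> \<open>This \<open>k\<close> turns the bound into
      \<open>2 * (1 + c) \<le> 1 + c\<close>.\<close>
    then show False using bound[of "(1 + c) / m"] c mult_nonneg_nonneg[OF c(2) m(2)] by (simp add: field_simps)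
  qed
  then show "N \<in> null_sets \<mu>" using m by (auto intro!: null_setsI)
qed

text \<open>The level sets of \<open>s\<close> need not be open. Each is enlarged to an open set of
  slightly larger measure; the resulting \<psi> dominates \<open>s\<close>, is locally minorised,
  and its squared integral exceeds that of \<open>s\<close> by at most \<open>e\<close>.\<close>

lemma nn_integral_simple_le:
  fixes s :: "real \<Rightarrow> ennreal"
  assumes s: "simple_function borel s" and fin: "\<And>x. s x < \<top>"
  shows "2 * (\<integral>\<^sup>+ x. s x \<partial>\<mu>) \<le> (\<integral>\<^sup>+ x. (s x)\<^sup>2 \<partial>lborel) + C"
proof (rule ennreal_le_epsilon)
  fix e :: real assume e: "0 < e"
  define A where "A y = s -` {y}" for y
  have [measurable]: "A y \<in> sets borel" for y
    using simple_functionD(2)[OF s, of "{y}"] by (simp add: A_def)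
  have F: "finite (range s)" using simple_functionD(1)[OF s] by simp
  have [measurable]: "s \<in> borel_measurable borel" using s by (rule borel_measurable_simple_function)
  \<comment> \<open>The sum of all values of \<open>s\<close>: a crude finite bound for
    \<open>s\<close> and also for the error \<open>t\<close>.\<close>
  define S where "S = (\<Sum>y\<in>range s. y)"
  have "S < \<top>" unfolding S_def using F fin by (auto simp: less_top[symmetric]) metis
  then obtain S' where S': "S = ennreal S'" "0 \<le> S'" by (cases S) auto
  \<comment> \<open>The error in the squared integral will be at most
    \<open>3 * S * (S * \<delta>)\<close>; the summand 1 covers the case
    \<open>S' = 0\<close>.\<close>
  define \<delta> where "\<delta> = e / (3 * S'\<^sup>2 + 1)"
  have \<delta>: "0 < \<delta>" "3 * S'\<^sup>2 * \<delta> \<le> e"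
    using e S'(2) by (auto simp: \<delta>_def field_simps add_pos_nonneg)
  have "\<exists>U. open U \<and> A y \<subseteq> U \<and> emeasure lborel (U - A y) \<le> ennreal \<delta>" for y
    by (rule outer_regular_lborel_le[of "A y", OF _ \<delta>(1)]) auto
  then obtain U where U: "\<And>y. open (U y)" "\<And>y. A y \<subseteq> U y" "\<And>y. emeasure lborel (U y - A y) \<le> ennreal \<delta>"
    by metis
  have [measurable]: "U y \<in> sets borel" for y using U(1) by simp
  define t where "t x = (\<Sum>y\<in>range s. y * indicator (U y - A y) x)" for x
  define \<psi> where "\<psi> x = (\<Sum>y\<in>range s. y * indicator (U y) x)" for x
  have [measurable]: "t \<in> borel_measurable borel" "\<psi> \<in> borel_measurable borel"
    unfolding t_def \<psi>_def by measurable
  have s_eq: "s x = (\<Sum>y\<in>range s. y * indicator (A y) x)" for x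
    using simple_function_indicator_representation[OF s, of x] by (simp only: A_def space_borel Int_UNIV_right UNIV_I)
  have \<psi>_eq: "\<psi> x = s x + t x" for x
    unfolding \<psi>_def t_def using U(2)
    by (subst s_eq, subst sum.distrib[symmetric])
       (intro sum.cong, auto simp: indicator_def subset_iff)
  have loc: "eventually (\<lambda>z. \<psi> x \<le> \<psi> z) (nhds x)" for x
  proof -
    have "eventually (\<lambda>z. \<forall>y\<in>range s. x \<in> U y \<longrightarrow> z \<in> U y) (nhds x)"
      using F U(1) by (intro eventually_ball_finite) (auto simp: eventually_nhds_in_open)
    then show ?thesis
      by eventually_elim (auto simp: \<psi>_def indicator_def intro!: sum_mono)
  qed
  have sS: "s x \<le> S" for x
    unfolding S_def using F by (intro member_le_sum) auto
  have tS: "t x \<le> S" for x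
    unfolding S_def t_def by (intro sum_mono) (auto simp: indicator_def)
  \<comment> \<open>Bounding \<open>s\<close> and one factor \<open>t\<close> by \<open>S\<close>
    makes the error linear in \<open>t\<close>, whose integral is small.\<close>
  have "(\<psi> x)\<^sup>2 \<le> (s x)\<^sup>2 + 3 * S * t x" for x
  proof -
    have "(\<psi> x)\<^sup>2 = (s x)\<^sup>2 + (2 * s x * t x + t x * t x)"
      unfolding \<psi>_eq by (simp add: power2_eq_square algebra_simps flip: mult_2)
    also have "\<dots> \<le> (s x)\<^sup>2 + (2 * S * t x + S * t x)"
      by (intro add_left_mono add_mono mult_right_mono mult_left_mono sS tS) auto
    also have "2 * S * t x + S * t x = 3 * S * t x"
    proof -
      have "(3 :: ennreal) = 2 + 1" by simp
      then show ?thesis by (simp only: distrib_right mult_1_left)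
    qed
    finally show ?thesis .
  qed
  then have "(\<integral>\<^sup>+ x. (\<psi> x)\<^sup>2 \<partial>lborel) \<le> (\<integral>\<^sup>+ x. (s x)\<^sup>2 + 3 * S * t x \<partial>lborel)"
    by (intro nn_integral_mono)
  also have "\<dots> = (\<integral>\<^sup>+ x. (s x)\<^sup>2 \<partial>lborel) + 3 * S * (\<integral>\<^sup>+ x. t x \<partial>lborel)"
    by (simp add: nn_integral_add nn_integral_cmult)
  also have "(\<integral>\<^sup>+ x. t x \<partial>lborel) = (\<Sum>y\<in>range s. y * emeasure lborel (U y - A y))"
    unfolding t_def by (simp add: nn_integral_sum nn_integral_cmult)
  also have "\<dots> \<le> (\<Sum>y\<in>range s. y * ennreal \<delta>)"
    by (intro sum_mono mult_left_mono U(3)) simp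
  also have "\<dots> = S * ennreal \<delta>" by (simp add: S_def sum_distrib_right)
  also have "3 * S * (S * ennreal \<delta>) = ennreal (3 * S'\<^sup>2 * \<delta>)"
    using S' \<delta>(1) by (simp add: ennreal_mult power2_eq_square mult_ac)
  also have "\<dots> \<le> ennreal e" using \<delta>(2) by (rule ennreal_leI)
  finally have "(\<integral>\<^sup>+ x. (\<psi> x)\<^sup>2 \<partial>lborel) \<le> (\<integral>\<^sup>+ x. (s x)\<^sup>2 \<partial>lborel) + ennreal e"
    by (simp add: mult_left_mono add_left_mono)
  from add_right_mono[OF this, of C]
  have "(\<integral>\<^sup>+ x. (\<psi> x)\<^sup>2 \<partial>lborel) + C \<le> (\<integral>\<^sup>+ x. (s x)\<^sup>2 \<partial>lborel) + C + ennreal e"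
    by (simp only: ac_simps)
  moreover have "2 * (\<integral>\<^sup>+ x. \<psi> x \<partial>\<mu>) \<le> (\<integral>\<^sup>+ x. (\<psi> x)\<^sup>2 \<partial>lborel) + C"
    using loc by (intro nn_integral_locally_minorised_le) auto
  moreover have "2 * (\<integral>\<^sup>+ x. s x \<partial>\<mu>) \<le> 2 * (\<integral>\<^sup>+ x. \<psi> x \<partial>\<mu>)"
    by (intro mult_left_mono nn_integral_mono) (auto simp: \<psi>_eq)
  ultimately show "2 * (\<integral>\<^sup>+ x. s x \<partial>\<mu>) \<le> (\<integral>\<^sup>+ x. (s x)\<^sup>2 \<partial>lborel) + C + ennreal e"
    by (meson order_trans)
qed

text \<open>For a simple function \<open>s i\<close> below the density \<open>L\<close>, the
  integral of its square is at most that of \<open>L * s i\<close>, which is its \<mu>-integral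
  \<open>p\<close>. The previous bound then reads \<open>2 * p \<le> p + C\<close>, so
  \<open>p \<le> C\<close>. Monotone convergence passes this on to the \<mu>-integral of
  \<open>L\<close>, which is the Lebesgue integral of its square.\<close>

lemma nn_integral_RN_deriv_square: "(\<integral>\<^sup>+ x. (RN_deriv lborel \<mu> x)\<^sup>2 \<partial>lborel) \<le> C"
proof -
  define L where "L = RN_deriv lborel \<mu>"
  have [measurable]: "L \<in> borel_measurable borel" unfolding L_def by measurable
  have \<mu>: "density lborel L = \<mu>"
    unfolding L_def using absolutely_continuous by (rule sigma_finite_measure.density_RN_deriv[OF sigma_finite_lborel]) simp
  obtain s where s: "\<And>i. simple_function borel (s i)" "incseq s" "\<And>i x. s i x < \<top>"
      "\<And>x. (SUP i. s i x) = L x"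
    using borel_measurable_implies_simple_function_sequence'[of L borel] by auto
  have [measurable]: "s i \<in> borel_measurable borel" for i
    using s(1) by (rule borel_measurable_simple_function)
  have int: "(\<integral>\<^sup>+ x. g x \<partial>\<mu>) = (\<integral>\<^sup>+ x. L x * g x \<partial>lborel)" if [measurable]: "g \<in> borel_measurable borel" for g
    by (subst \<mu>[symmetric], subst nn_integral_density) auto
  have le: "(\<integral>\<^sup>+ x. s i x \<partial>\<mu>) \<le> C" for i
  proof -
    define S where "S = Max (range (s i))"
    have F: "finite (range (s i))" using simple_functionD(1)[OF s(1)] by simp
    have "S < \<top>" unfolding S_def using F s(3) by auto
    \<comment> \<open>The integral must be finite for the later cancellation; it is, since
      \<open>s i\<close> is bounded and \<mu> is finite.\<close>
    have "(\<integral>\<^sup>+ x. s i x \<partial>\<mu>) \<le> (\<integral>\<^sup>+ x. S \<partial>\<mu>)"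
      unfolding S_def using F by (intro nn_integral_mono) simp
    also have "\<dots> < \<top>" using \<open>S < \<top>\<close> emeasure_finite by (simp add: ennreal_mult_eq_top_iff less_top[symmetric])
    finally obtain p where p: "(\<integral>\<^sup>+ x. s i x \<partial>\<mu>) = ennreal p" "0 \<le> p" by (auto simp: less_top_ennreal)
    have "(\<integral>\<^sup>+ x. (s i x)\<^sup>2 \<partial>lborel) \<le> (\<integral>\<^sup>+ x. L x * s i x \<partial>lborel)"
      unfolding power2_eq_square s(4)[symmetric]
      by (intro nn_integral_mono mult_right_mono SUP_upper) auto
    then have q: "(\<integral>\<^sup>+ x. (s i x)\<^sup>2 \<partial>lborel) \<le> ennreal p"
      using int[of "s i"] p by simp
    have "2 * ennreal p \<le> (\<integral>\<^sup>+ x. (s i x)\<^sup>2 \<partial>lborel) + C"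
      using nn_integral_simple_le[OF s(1) s(3), of i] p by simp
    also have "\<dots> \<le> ennreal p + C" using q by (rule add_right_mono)
    finally have "ennreal p + ennreal p \<le> ennreal p + C" by (simp add: mult_2)
    then show ?thesis unfolding p by (simp add: ennreal_add_left_cancel_le)
  qed
  have "(\<integral>\<^sup>+ x. (L x)\<^sup>2 \<partial>lborel) = (\<integral>\<^sup>+ x. (SUP i. s i x) \<partial>\<mu>)"
    unfolding s(4) by (simp add: int power2_eq_square)
  also have "\<dots> = (SUP i. \<integral>\<^sup>+ x. s i x \<partial>\<mu>)"
    using s(2) by (intro nn_integral_monotone_convergence_SUP) auto
  also have "\<dots> \<le> C" by (intro SUP_least le)
  finally show ?thesis unfolding L_def .
qed

end

section \<open>From close pairs of times on a path to its occupation density\<close>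

section \<open>Occupation densities of fractional Brownian motion\<close>

text \<open>For measurable \<open>g\<close>, dividing by \<open>2 * \<rho>\<close> gives the energy
  of the occupation measure of \<open>g\<close> at scale \<rho>. Indicators of \<open>I\<close> in
  place of a restricted measure keep both integrals over \<open>lborel\<close>, ready for Fubini
  with the probability measure.\<close>

definition close_pairs :: "(real \<Rightarrow> real) \<Rightarrow> real set \<Rightarrow> real \<Rightarrow> ennreal" where
  "close_pairs g I \<rho> =
     (\<integral>\<^sup>+ s. (\<integral>\<^sup>+ t. indicator {..<2 * \<rho>} \<bar>g s - g t\<bar> * indicator I t \<partial>lborel) * indicator I s \<partial>lborel)"

text \<open>Scaling a path by \<open>c\<close> scales all its increments, so the pairs of
  \<open>f\<close> within \<open>2 * (c * \<rho> n)\<close> are exactly the pairs of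
  \<open>g\<close> within \<open>2 * \<rho> n\<close>. Hence the occupation measure of
  \<open>f\<close> has bounded energy along the scales \<open>c * \<rho> n\<close>, with
  \<open>D\<close> divided by \<open>c\<close>.\<close>

lemma occupation_density_of_close_pairs:
  fixes f g :: "real \<Rightarrow> real" and c :: real and \<rho> :: "nat \<Rightarrow> real" and D :: ennreal
  assumes I[measurable]: "I \<in> sets borel" and bdd: "emeasure lborel I < \<infinity>"
    and g[measurable]: "g \<in> borel_measurable borel" and f: "\<And>t. t \<in> I \<Longrightarrow> f t = c * g t" and c: "0 < c"
    and \<rho>: "\<And>n. 0 < \<rho> n" "\<rho> \<longlonglongrightarrow> 0"
    and cp: "\<And>n. close_pairs g I (\<rho> n) \<le> ennreal (2 * \<rho> n) * D" and D: "D < \<infinity>"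
  shows "has_occupation_density f I" "(\<integral>\<^sup>+ x. (occupation_density f I x)\<^sup>2 \<partial>lborel) < \<infinity>"
proof -
  let ?R = "restrict_space lborel I"
  define \<mu> where "\<mu> = occupation_measure f I"
  have g'[measurable]: "g \<in> borel_measurable ?R" by (rule measurable_restrict_space1) simp
  have fR[measurable]: "f \<in> borel_measurable ?R"
  proof (subst measurable_cong)
    show "f t = c * g t" if "t \<in> space ?R" for t
      using that f by (simp add: space_restrict_space)
  qed measurable
  have sets[measurable_cong, simp]: "sets \<mu> = sets borel" by (simp add: \<mu>_def occupation_measure_def)
  have fin: "finite_measure \<mu>"
    unfolding \<mu>_def occupation_measure_def
    using bdd by (intro finite_measure.finite_measure_distr fR finite_measureI)
      (simp add: emeasure_restrict_space space_restrict_space less_top)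
  then interpret finite_measure \<mu> .
  have R: "(\<integral>\<^sup>+ x. h x \<partial>\<mu>) = (\<integral>\<^sup>+ t. h (f t) * indicator I t \<partial>lborel)" if [measurable]: "h \<in> borel_measurable borel"
    for h :: "real \<Rightarrow> ennreal"
    unfolding \<mu>_def occupation_measure_def
    by (simp add: nn_integral_distr nn_integral_restrict_space)
  have "bounded_energy \<mu> (\<lambda>n. c * \<rho> n) (ennreal (1 / c) * D)"
  proof
    show "sets \<mu> = sets borel" by simp
    show "0 < c * \<rho> n" for n using c \<rho>(1) by simp
    show "(\<lambda>n. c * \<rho> n) \<longlonglongrightarrow> 0" using tendsto_mult_right_zero[OF \<rho>(2)] by simp
    show "ennreal (1 / c) * D < \<infinity>" using D by (simp add: ennreal_mult_less_top)
    fix n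
    have "(\<integral>\<^sup>+ x. \<integral>\<^sup>+ y. indicator {..<2 * (c * \<rho> n)} \<bar>x - y\<bar> \<partial>\<mu> \<partial>\<mu>) =
        (\<integral>\<^sup>+ s. (\<integral>\<^sup>+ t. indicator {..<2 * (c * \<rho> n)} \<bar>f s - f t\<bar> * indicator I t \<partial>lborel) * indicator I s \<partial>lborel)"
      by (subst R) (measurable, simp add: R)
    also have "\<dots> = close_pairs g I (\<rho> n)"
      unfolding close_pairs_def
    proof (intro nn_integral_cong)
      fix s
      have eq: "(indicator {..<2 * (c * \<rho> n)} \<bar>f s - f t\<bar> :: ennreal) = indicator {..<2 * \<rho> n} \<bar>g s - g t\<bar>"
        if "s \<in> I" "t \<in> I" for t
      proof -
        have "\<bar>f s - f t\<bar> = c * \<bar>g s - g t\<bar>"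
          using c that by (simp add: f abs_mult flip: right_diff_distrib)
        then show ?thesis
          using c by (simp add: indicator_def mult.left_commute[of 2])
      qed
      have "(\<integral>\<^sup>+ t. indicator {..<2 * (c * \<rho> n)} \<bar>f s - f t\<bar> * indicator I t \<partial>lborel) =
          (\<integral>\<^sup>+ t. indicator {..<2 * \<rho> n} \<bar>g s - g t\<bar> * indicator I t \<partial>lborel)" if "s \<in> I"
      proof (intro nn_integral_cong)
        fix t
        show "(indicator {..<2 * (c * \<rho> n)} \<bar>f s - f t\<bar> :: ennreal) * indicator I t =
            indicator {..<2 * \<rho> n} \<bar>g s - g t\<bar> * indicator I t"
          by (cases "t \<in> I") (simp_all add: eq[OF that])
      qed
      then show "(\<integral>\<^sup>+ t. indicator {..<2 * (c * \<rho> n)} \<bar>f s - f t\<bar> * indicator I t \<partial>lborel) * indicator I s =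
          (\<integral>\<^sup>+ t. indicator {..<2 * \<rho> n} \<bar>g s - g t\<bar> * indicator I t \<partial>lborel) * indicator I s"
        by (cases "s \<in> I") simp_all
    qed
    also have "\<dots> \<le> ennreal (2 * \<rho> n) * D" by (rule cp)
    also have "\<dots> = ennreal (2 * (c * \<rho> n)) * (ennreal (1 / c) * D)"
      using c \<rho>(1)[of n] by (simp add: mult.assoc[symmetric] ennreal_mult[symmetric])
    finally show "(\<integral>\<^sup>+ x. \<integral>\<^sup>+ y. indicator {..<2 * (c * \<rho> n)} \<bar>x - y\<bar> \<partial>\<mu> \<partial>\<mu>) \<le>
        ennreal (2 * (c * \<rho> n)) * (ennreal (1 / c) * D)" .
  qed
  then interpret E: bounded_energy \<mu> "\<lambda>n. c * \<rho> n" "ennreal (1 / c) * D" .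
  show "has_occupation_density f I"
    using E.absolutely_continuous by (simp add: has_occupation_density_def fR \<mu>_def)
  show "(\<integral>\<^sup>+ x. (occupation_density f I x)\<^sup>2 \<partial>lborel) < \<infinity>"
    using E.nn_integral_RN_deriv_square E.C_finite
    unfolding occupation_density_def \<mu>_def by (rule le_less_trans)
qed

text \<open>If only finitely many terms were at most \<open>liminf u + 1\<close>, the lower limit
  would be at least itself plus 1, which is impossible for a finite value.\<close>

lemma subseq_le_of_liminf_finite:
  fixes u :: "nat \<Rightarrow> ennreal"
  assumes "liminf u < \<infinity>"
  obtains D k where "D < \<infinity>" "strict_mono (k :: nat \<Rightarrow> nat)" "\<And>n. u (k n) \<le> D"
proof -
  define D where "D = liminf u + 1"
  have D: "D < \<infinity>" using assms by (simp add: D_def)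
  have "infinite {n. u n \<le> D}"
  proof
    assume "finite {n. u n \<le> D}"
    then have "eventually (\<lambda>n. \<not> u n \<le> D) sequentially"
      by (simp add: eventually_cofinite flip: cofinite_eq_sequentially)
    then have "eventually (\<lambda>n. D \<le> u n) sequentially"
      by eventually_elim simp
    then have "D \<le> liminf u" by (rule Liminf_bounded)
    with assms show False unfolding D_def
      by (cases "liminf u") (auto simp: ennreal_plus[symmetric] simp del: ennreal_plus simp flip: ennreal_1)
  qed
  then obtain k :: "nat \<Rightarrow> nat" where "strict_mono k" "\<And>n. k n \<in> {n. u n \<le> D}"
    using infinite_enumerate by metis
  with D that show ?thesis by auto
qed

lemma nn_integral_powr_kernel_le:
  fixes h s :: real
  assumes "h < 1"
  shows "(\<integral>\<^sup>+ t. ennreal (\<bar>s - t\<bar> powr (- h)) * indicator {0..1} t \<partial>lborel) * indicator {0..1} s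
    \<le> ennreal (2 / (1 - h)) * indicator {0..1} s"
proof (cases "s \<in> {0..1}")
  case True
  define F :: "real \<Rightarrow> ennreal" where "F u = ennreal (u powr (- h)) * indicator {0..1} u" for u
  have [measurable]: "F \<in> borel_measurable borel" unfolding F_def by measurable
  have "((\<lambda>u. u powr (- h)) has_integral (1 / (1 - h))) {0..1}"
    using has_integral_powr_from_0[of "- h" 1] assms by simp
  then have F: "(\<integral>\<^sup>+ u. F u \<partial>lborel) = ennreal (1 / (1 - h))"
    unfolding F_def by (intro nn_integral_has_integral_lebesgue') auto
  \<comment> \<open>The two summands cover the times before and after \<open>s\<close>. They are
    written as affine maps of \<open>t\<close> to match the substitution rule, and each integrates
    to \<open>1 / (1 - h)\<close>.\<close>
  have "(\<integral>\<^sup>+ t. ennreal (\<bar>s - t\<bar> powr (- h)) * indicator {0..1} t \<partial>lborel) \<le>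
      (\<integral>\<^sup>+ t. F (s + (-1) * t) + F (- s + 1 * t) \<partial>lborel)"
    using True by (intro nn_integral_mono) (auto simp: F_def indicator_def abs_if)
  also have "\<dots> = (\<integral>\<^sup>+ t. F (s + (-1) * t) \<partial>lborel) + (\<integral>\<^sup>+ t. F (- s + 1 * t) \<partial>lborel)"
    by (rule nn_integral_add) measurable
  also have "\<dots> = ennreal (1 / (1 - h)) + ennreal (1 / (1 - h))"
    using nn_integral_real_affine[of F "-1" s] nn_integral_real_affine[of F 1 "- s"] by (simp add: F)
  also have "\<dots> = ennreal (2 / (1 - h))"
    using assms by (simp flip: ennreal_plus add_divide_distrib)
  finally show ?thesis using True by simp
qed simp

section \<open>Gaussian increments and the expected energy of fractional Brownian paths\<close>

context prob_space
begin

text \<open>This identifies the unspecified parameters of a normal law from expectation and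
  variance, and supplies the integrability behind them. In the degenerate case the variable is
  almost surely constant.\<close>

lemma normal_law_moments:
  assumes Z[measurable]: "random_variable borel Z" and \<sigma>: "0 \<le> \<sigma>"
    and law: "distr M borel Z = normal_law m \<sigma>"
  shows "integrable M Z" "integrable M (\<lambda>\<omega>. (Z \<omega>)\<^sup>2)" "expectation Z = m" "variance Z = \<sigma>\<^sup>2"
proof -
  have "integrable M Z \<and> integrable M (\<lambda>\<omega>. (Z \<omega>)\<^sup>2) \<and> expectation Z = m \<and> variance Z = \<sigma>\<^sup>2"
  proof (cases "\<sigma> = 0")
    case True
    have "AE x in return borel m. x = m" by (simp add: AE_return)
    moreover have "distr M borel Z = return borel m" using law True by (simp add: normal_law_def)
    ultimately have "AE x in distr M borel Z. x = m" by (simp only:)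
    then have ae: "AE \<omega> in M. Z \<omega> = m" by (simp add: AE_distr_iff)
    have "expectation Z = (\<integral>\<omega>. m \<partial>M)" using ae by (intro integral_cong_AE) auto
    then have e: "expectation Z = m" by (simp add: prob_space)
    have "variance Z = (\<integral>\<omega>. 0 \<partial>M)" unfolding e using ae by (intro integral_cong_AE) auto
    moreover have "integrable M Z = integrable M (\<lambda>\<omega>. m)" 
      using ae by (intro integrable_cong_AE) auto
    moreover have "integrable M (\<lambda>\<omega>. (Z \<omega>)\<^sup>2) = integrable M (\<lambda>\<omega>. m\<^sup>2)"
      using ae by (intro integrable_cong_AE) auto
    ultimately show ?thesis using e True by simp
  next
    case False
    then have pos: "0 < \<sigma>" using \<sigma> by simp
    have "distr M lborel Z = distr M borel Z" by (rule distr_cong) auto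
    then have d: "distributed M lborel Z (\<lambda>x. ennreal (normal_density m \<sigma> x))"
      using law False by (simp add: distributed_def normal_law_def)
    have int: "integrable M (\<lambda>\<omega>. (Z \<omega> - m) ^ k)" for k
      using distributed_integrable[OF d, of "\<lambda>x. (x - m) ^ k"] integrable_normal_moment[OF pos, of m k]
      by simp
    have i1: "integrable M Z" using Bochner_Integration.integrable_add[OF int[of 1], of "\<lambda>_. m"] by simp
    \<comment> \<open>The integrand is the square of \<open>Z\<close>, split into a central moment
      and an affine function of \<open>Z\<close>.\<close>
    have "integrable M (\<lambda>\<omega>. (Z \<omega> - m)\<^sup>2 + (2 * m * Z \<omega> - m\<^sup>2))"
      by (intro Bochner_Integration.integrable_add int Bochner_Integration.integrable_diff
          integrable_mult_right i1) simp
    then have "integrable M (\<lambda>\<omega>. (Z \<omega>)\<^sup>2)"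
      by (simp add: power2_eq_square algebra_simps)
    with i1 show ?thesis
      using normal_distributed_expectation[OF pos d] normal_distributed_variance[OF pos d] by simp
  qed
  then show "integrable M Z" "integrable M (\<lambda>\<omega>. (Z \<omega>)\<^sup>2)" "expectation Z = m" "variance Z = \<sigma>\<^sup>2"
    by auto
qed

text \<open>The normal density is at most \<open>1 / \<sigma>\<close>, as
  \<open>2 * pi \<ge> 1\<close>, and the event confines \<open>Z\<close> to an interval of length
  \<open>2 * a\<close>. The bound holds for every mean.\<close>

lemma normal_law_small_ball:
  assumes Z[measurable]: "random_variable borel Z" and \<sigma>: "0 < \<sigma>" and a: "0 < a"
    and law: "distr M borel Z = normal_law m \<sigma>"
  shows "(\<integral>\<^sup>+ \<omega>. indicator {..<a} \<bar>Z \<omega>\<bar> \<partial>M) \<le> ennreal (2 * a / \<sigma>)"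
proof -
  have dens: "normal_density m \<sigma> x \<le> 1 / \<sigma>" for x
  proof -
    have "1 * \<sigma>\<^sup>2 \<le> 2 * pi * \<sigma>\<^sup>2"
      using pi_gt3 by (intro mult_right_mono) auto
    then have "\<sigma> \<le> sqrt (2 * pi * \<sigma>\<^sup>2)"
      using \<sigma> by (intro real_le_rsqrt) simp
    then have "1 / sqrt (2 * pi * \<sigma>\<^sup>2) \<le> 1 / \<sigma>"
      using \<sigma> by (intro divide_left_mono) auto
    moreover have "exp (- (x - m)\<^sup>2 / (2 * \<sigma>\<^sup>2)) \<le> 1" by simp
    ultimately have "1 / sqrt (2 * pi * \<sigma>\<^sup>2) * exp (- (x - m)\<^sup>2 / (2 * \<sigma>\<^sup>2)) \<le> 1 / \<sigma> * 1"
      using \<sigma> by (intro mult_mono) auto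
    then show ?thesis by (simp add: normal_density_def)
  qed
  have "(\<integral>\<^sup>+ \<omega>. indicator {..<a} \<bar>Z \<omega>\<bar> \<partial>M) = (\<integral>\<^sup>+ x. indicator {..<a} \<bar>x\<bar> \<partial>distr M borel Z)"
    by (simp add: nn_integral_distr)
  also have "\<dots> = (\<integral>\<^sup>+ x. ennreal (normal_density m \<sigma> x) * indicator {..<a} \<bar>x\<bar> \<partial>lborel)"
    using \<sigma> by (simp add: law normal_law_def nn_integral_density)
  also have "\<dots> \<le> (\<integral>\<^sup>+ x. ennreal (1 / \<sigma>) * indicator {..<a} \<bar>0 - x\<bar> \<partial>lborel)"
    by (intro nn_integral_mono mult_mono ennreal_leI dens) auto
  also have "\<dots> = ennreal (2 * a / \<sigma>)"
    using a \<sigma> by (subst nn_integral_cmult)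
      (simp_all add: nn_integral_indicator_near[OF a, of 0, simplified] ennreal_mult[symmetric])
  finally show ?thesis .
qed

text \<open>Expanding the square of the increment and inserting the covariances leaves the variance
  \<open>\<bar>s - t\<bar> powr (2 * h)\<close>. The mean may stay unspecified because the small
  ball estimate is uniform in it.\<close>

lemma fBm_increment_law:
  assumes B: "fractional_Brownian_motion h B" and st: "0 \<le> s" "0 \<le> t" "s \<noteq> t"
  shows "\<exists>m. distr M borel (\<lambda>\<omega>. B s \<omega> - B t \<omega>) = normal_law m (\<bar>s - t\<bar> powr h)"
proof -
  have rv[measurable]: "random_variable borel (B u)" if "0 \<le> u" for u
    using B that by (auto simp: fractional_Brownian_motion_def gaussian_process_def)
  have gauss: "\<exists>m \<sigma>. 0 \<le> \<sigma> \<and> distr M borel (\<lambda>\<omega>. \<Sum>u\<in>F. c u * B u \<omega>) = normal_law m \<sigma>"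
    if "finite F" "F \<subseteq> {0..}" for F c
    using B that by (auto simp: fractional_Brownian_motion_def gaussian_process_def)
  have mean: "expectation (B u) = 0" if "0 \<le> u" for u
    using B that by (auto simp: fractional_Brownian_motion_def)
  have cov: "expectation (\<lambda>\<omega>. B u \<omega> * B v \<omega>) = (v powr (2 * h) + u powr (2 * h) - \<bar>v - u\<bar> powr (2 * h)) / 2"
    if "0 \<le> u" "0 \<le> v" for u v
    using B that by (auto simp: fractional_Brownian_motion_def)
  have int: "integrable M (B u)" "integrable M (\<lambda>\<omega>. (B u \<omega>)\<^sup>2)" if u: "0 \<le> u" for u
  proof -
    \<comment> \<open>A one-point linear combination shows that each \<open>B u\<close> is normal,
      hence square integrable; this makes linearity of the expectation available below.\<close>
    obtain m \<sigma> where "0 \<le> \<sigma>" "distr M borel (B u) = normal_law m \<sigma>"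
      using gauss[of "{u}" "\<lambda>_. 1"] u by auto
    then show "integrable M (B u)" "integrable M (\<lambda>\<omega>. (B u \<omega>)\<^sup>2)"
      using normal_law_moments rv[OF u] by blast+
  qed
  have intp: "integrable M (\<lambda>\<omega>. B s \<omega> * B t \<omega>)"
  proof (rule Bochner_Integration.integrable_bound)
    show "integrable M (\<lambda>\<omega>. (B s \<omega>)\<^sup>2 + (B t \<omega>)\<^sup>2)" using int st by simp
    show "(\<lambda>\<omega>. B s \<omega> * B t \<omega>) \<in> borel_measurable M" using st by simp
    have "\<bar>x * y\<bar> \<le> x\<^sup>2 + y\<^sup>2" for x y :: real
      using sum_squares_bound[of "\<bar>x\<bar>" "\<bar>y\<bar>"] mult_nonneg_nonneg[of "\<bar>x\<bar>" "\<bar>y\<bar>"]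
      unfolding abs_mult power2_abs by linarith
    then show "AE \<omega> in M. norm (B s \<omega> * B t \<omega>) \<le> norm ((B s \<omega>)\<^sup>2 + (B t \<omega>)\<^sup>2)"
      by simp
  qed
  define Z where "Z \<omega> = B s \<omega> - B t \<omega>" for \<omega>
  have [measurable]: "random_variable borel Z" unfolding Z_def using st by measurable
  obtain m \<sigma> where law: "0 \<le> \<sigma>" "distr M borel Z = normal_law m \<sigma>"
    using gauss[of "{s, t}" "\<lambda>u. if u = s then 1 else - 1"] st unfolding Z_def by auto
  have "expectation Z = 0" unfolding Z_def using int st mean by simp
  then have "variance Z = expectation (\<lambda>\<omega>. (B s \<omega>)\<^sup>2 + (B t \<omega>)\<^sup>2 - 2 * (B s \<omega> * B t \<omega>))"
    unfolding Z_def by (simp add: power2_diff mult.assoc)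
  also have "\<dots> = expectation (\<lambda>\<omega>. (B s \<omega>)\<^sup>2) + expectation (\<lambda>\<omega>. (B t \<omega>)\<^sup>2) - 2 * expectation (\<lambda>\<omega>. B s \<omega> * B t \<omega>)"
    using int st intp by simp
  also have "\<dots> = \<bar>s - t\<bar> powr (2 * h)"
    using cov[of s s] cov[of t t] cov[of s t] st by (simp add: power2_eq_square abs_minus_commute)
  also have "\<dots> = (\<bar>s - t\<bar> powr h)\<^sup>2" by (simp add: power2_eq_square flip: powr_add)
  finally have "\<sigma>\<^sup>2 = (\<bar>s - t\<bar> powr h)\<^sup>2"
    using normal_law_moments(4)[OF _ law] by simp
  then have "\<sigma> = \<bar>s - t\<bar> powr h" using law(1) by (simp add: power2_eq_iff_nonneg)
  with law(2) show ?thesis unfolding Z_def by auto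
qed

text \<open>Time is rounded down to a multiple of \<open>1 / (n + 1)\<close>. The rounded process
  takes only countably many times and is therefore jointly measurable; by continuity of the paths it
  converges pointwise to \<open>W\<close>.\<close>

lemma jointly_measurable_of_continuous:
  fixes W :: "real \<Rightarrow> 'a \<Rightarrow> real"
  assumes rv: "\<And>t. random_variable borel (W t)"
    and cont: "\<And>\<omega>. \<omega> \<in> space M \<Longrightarrow> continuous_on UNIV (\<lambda>t. W t \<omega>)"
  shows "(\<lambda>(t, \<omega>). W t \<omega>) \<in> borel_measurable (borel \<Otimes>\<^sub>M M)"
proof (rule borel_measurable_LIMSEQ_real)
  define q :: "nat \<Rightarrow> real \<Rightarrow> real" where "q n t = real_of_int \<lfloor>real (Suc n) * t\<rfloor> / real (Suc n)" for n t
  have q: "(\<lambda>n. q n t) \<longlonglongrightarrow> t" for t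
  proof (rule LIMSEQ_I)
    fix e :: real assume "0 < e"
    then obtain N where N: "1 / real (Suc N) < e" using nat_approx_posE by auto
    show "\<exists>N. \<forall>n\<ge>N. norm (q n t - t) < e"
    proof (intro exI allI impI)
      fix n assume "N \<le> n"
      then have "1 / real (Suc n) \<le> 1 / real (Suc N)" by (simp add: field_simps)
      moreover have "\<bar>q n t - t\<bar> \<le> 1 / real (Suc n)"
      proof -
        have "\<bar>real_of_int \<lfloor>real (Suc n) * t\<rfloor> - real (Suc n) * t\<bar> \<le> 1" by linarith
        moreover have "q n t - t = (real_of_int \<lfloor>real (Suc n) * t\<rfloor> - real (Suc n) * t) / real (Suc n)"
          unfolding q_def by (simp add: diff_divide_distrib del: of_nat_Suc)
        ultimately show ?thesis by (simp add: divide_right_mono del: of_nat_Suc)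
      qed
      ultimately show "norm (q n t - t) < e" using N by simp
    qed
  qed
  show "(\<lambda>n. case x of (t, \<omega>) \<Rightarrow> W (q n t) \<omega>) \<longlonglongrightarrow> (case x of (t, \<omega>) \<Rightarrow> W t \<omega>)"
    if x_in: "x \<in> space (borel \<Otimes>\<^sub>M M)" for x
  proof -
    obtain t \<omega> where x: "x = (t, \<omega>)" "\<omega> \<in> space M" using x_in by (cases x) (auto simp: space_pair_measure)
    have "isCont (\<lambda>t. W t \<omega>) t" using cont[OF x(2)] by (simp add: continuous_on_eq_continuous_at)
    then show ?thesis using isCont_tendsto_compose[OF _ q] x(1) by auto
  qed
  fix n
  have "(\<lambda>x. W (real_of_int i / real (Suc n)) (snd x)) \<in> borel_measurable (borel \<Otimes>\<^sub>M M)" for i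
    using rv by measurable
  moreover have "(\<lambda>x. \<lfloor>real (Suc n) * fst x\<rfloor>) \<in> borel \<Otimes>\<^sub>M M \<rightarrow>\<^sub>M count_space UNIV"
    by measurable
  ultimately have "(\<lambda>x. W (real_of_int \<lfloor>real (Suc n) * fst x\<rfloor> / real (Suc n)) (snd x)) \<in> borel_measurable (borel \<Otimes>\<^sub>M M)"
    by (rule measurable_compose_countable)
  then show "(\<lambda>x. case x of (t, \<omega>) \<Rightarrow> W (q n t) \<omega>) \<in> borel_measurable (borel \<Otimes>\<^sub>M M)"
    by (simp add: q_def case_prod_unfold)
qed

text \<open>Fubini brings the expectation inside, where it becomes the probability that an increment
  is smaller than \<open>2 * \<rho>\<close>. The small ball estimate bounds it by
  \<open>4 * \<rho> * \<bar>s - t\<bar> powr (- h)\<close>, and this kernel is integrable as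
  \<open>h < 1\<close>. \<open>W\<close> extends \<open>B\<close> to all real times, so that joint
  measurability can be stated over \<open>borel\<close>.\<close>

lemma fBm_expected_close_pairs:
  fixes W :: "real \<Rightarrow> 'a \<Rightarrow> real"
  assumes B: "fractional_Brownian_motion h B" and h: "h < 1"
    and W: "\<And>t \<omega>. 0 \<le> t \<Longrightarrow> W t \<omega> = B t \<omega>"
    and meas[measurable]: "(\<lambda>(t, \<omega>). W t \<omega>) \<in> borel_measurable (borel \<Otimes>\<^sub>M M)"
    and I[measurable]: "I \<in> sets borel" and sub: "I \<subseteq> {0..1}" and \<rho>: "0 < \<rho>"
  shows "(\<integral>\<^sup>+ \<omega>. close_pairs (\<lambda>t. W t \<omega>) I \<rho> \<partial>M) \<le> ennreal (2 * \<rho>) * ennreal (4 / (1 - h))"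
proof -
  interpret L: pair_sigma_finite M lborel ..
  define k :: "real \<Rightarrow> real \<Rightarrow> 'a \<Rightarrow> ennreal"
    where "k s t \<omega> = indicator {..<2 * \<rho>} \<bar>W s \<omega> - W t \<omega>\<bar>" for s t \<omega>
  have [measurable (raw)]: "(\<lambda>x. k (a x) (b x) (c x)) \<in> borel_measurable N"
    if [measurable]: "a \<in> borel_measurable N" "b \<in> borel_measurable N" "c \<in> N \<rightarrow>\<^sub>M M" for a b c and N :: "'c measure"
    using measurable_compose[OF measurable_Pair[OF that(1) that(3)] meas]
      measurable_compose[OF measurable_Pair[OF that(2) that(3)] meas]
    unfolding k_def by simp
  have "(\<integral>\<^sup>+ \<omega>. close_pairs (\<lambda>t. W t \<omega>) I \<rho> \<partial>M) =
      (\<integral>\<^sup>+ s. \<integral>\<^sup>+ \<omega>. (\<integral>\<^sup>+ t. k s t \<omega> * indicator I t \<partial>lborel) * indicator I s \<partial>M \<partial>lborel)"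
    unfolding close_pairs_def k_def by (rule L.Fubini'[symmetric]) measurable
  also have "\<dots> = (\<integral>\<^sup>+ s. (\<integral>\<^sup>+ \<omega>. \<integral>\<^sup>+ t. k s t \<omega> * indicator I t \<partial>lborel \<partial>M) * indicator I s \<partial>lborel)"
    by (intro nn_integral_cong nn_integral_multc) measurable
  also have "\<dots> = (\<integral>\<^sup>+ s. (\<integral>\<^sup>+ t. \<integral>\<^sup>+ \<omega>. k s t \<omega> * indicator I t \<partial>M \<partial>lborel) * indicator I s \<partial>lborel)"
    by (intro nn_integral_cong arg_cong2[where f="(*)"] refl L.Fubini'[symmetric]) measurable
  also have "\<dots> = (\<integral>\<^sup>+ s. (\<integral>\<^sup>+ t. (\<integral>\<^sup>+ \<omega>. k s t \<omega> \<partial>M) * indicator I t \<partial>lborel) * indicator I s \<partial>lborel)"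
    by (intro nn_integral_cong arg_cong2[where f="(*)"] refl nn_integral_multc) measurable
  also have "\<dots> \<le> (\<integral>\<^sup>+ s. (\<integral>\<^sup>+ t. ennreal (4 * \<rho>) * (ennreal (\<bar>s - t\<bar> powr (- h)) * indicator {0..1} t) \<partial>lborel)
      * indicator {0..1} s \<partial>lborel)"
  proof (intro nn_integral_mono)
    fix s
    show "(\<integral>\<^sup>+ t. (\<integral>\<^sup>+ \<omega>. k s t \<omega> \<partial>M) * indicator I t \<partial>lborel) * indicator I s \<le>
       (\<integral>\<^sup>+ t. ennreal (4 * \<rho>) * (ennreal (\<bar>s - t\<bar> powr (- h)) * indicator {0..1} t) \<partial>lborel) * indicator {0..1} s"
    proof (cases "s \<in> I")
      case True
      have "(\<integral>\<^sup>+ t. (\<integral>\<^sup>+ \<omega>. k s t \<omega> \<partial>M) * indicator I t \<partial>lborel) \<le>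
          (\<integral>\<^sup>+ t. ennreal (4 * \<rho>) * (ennreal (\<bar>s - t\<bar> powr (- h)) * indicator {0..1} t) \<partial>lborel)"
      proof (rule nn_integral_mono_AE)
        \<comment> \<open>The diagonal has to be discarded: there the probability is 1, while
          \<open>0 powr (- h)\<close> is 0.\<close>
        have "AE t in lborel. t \<noteq> s" by (rule AE_lborel_singleton)
        then show "AE t in lborel. (\<integral>\<^sup>+ \<omega>. k s t \<omega> \<partial>M) * indicator I t \<le>
            ennreal (4 * \<rho>) * (ennreal (\<bar>s - t\<bar> powr (- h)) * indicator {0..1} t)"
        proof eventually_elim
          case (elim t)
          show ?case
          proof (cases "t \<in> I")
            case t: True
            have st: "0 \<le> s" "0 \<le> t" "s \<noteq> t" "t \<in> {0..1}" using True t sub elim by auto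
            obtain m where m: "distr M borel (\<lambda>\<omega>. B s \<omega> - B t \<omega>) = normal_law m (\<bar>s - t\<bar> powr h)"
              using fBm_increment_law[OF B st(1-3)] by auto
            have [measurable]: "random_variable borel (B s)" "random_variable borel (B t)"
              using B st by (auto simp: fractional_Brownian_motion_def gaussian_process_def)
            have "(\<integral>\<^sup>+ \<omega>. k s t \<omega> \<partial>M) \<le> ennreal (2 * (2 * \<rho>) / \<bar>s - t\<bar> powr h)"
              unfolding k_def W[OF st(1)] W[OF st(2)] using st \<rho>
              by (intro normal_law_small_ball[OF _ _ _ m]) auto
            also have "\<dots> = ennreal (4 * \<rho>) * ennreal (\<bar>s - t\<bar> powr (- h))"
              using \<rho> by (simp add: powr_minus divide_inverse ennreal_mult)
            finally show ?thesis using t st(4) by simp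
          qed simp
        qed
      qed
      then show ?thesis using True sub by (auto simp: indicator_def)
    qed simp
  qed
  also have "\<dots> = (\<integral>\<^sup>+ s. ennreal (4 * \<rho>) * ((\<integral>\<^sup>+ t. ennreal (\<bar>s - t\<bar> powr (- h)) * indicator {0..1} t \<partial>lborel)
      * indicator {0..1} s) \<partial>lborel)"
    by (intro nn_integral_cong) (simp add: nn_integral_cmult mult.assoc)
  also have "\<dots> \<le> (\<integral>\<^sup>+ s. ennreal (4 * \<rho>) * (ennreal (2 / (1 - h)) * indicator {0..1 :: real} s) \<partial>lborel)"
  proof (rule nn_integral_mono)
    fix s :: real
    show "ennreal (4 * \<rho>) * ((\<integral>\<^sup>+ t. ennreal (\<bar>s - t\<bar> powr (- h)) * indicator {0..1} t \<partial>lborel)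
        * indicator {0..1} s) \<le> ennreal (4 * \<rho>) * (ennreal (2 / (1 - h)) * indicator {0..1} s)"
      using nn_integral_powr_kernel_le[OF h, of s] by (rule mult_left_mono) simp
  qed
  also have "\<dots> = ennreal (4 * \<rho>) * ennreal (2 / (1 - h))"
    by (simp add: nn_integral_cmult)
  also have "\<dots> = ennreal (2 * \<rho>) * ennreal (4 / (1 - h))"
    using \<rho> h by (simp flip: ennreal_mult)
  finally show ?thesis .
qed

text \<open>The normalised quantities \<open>u n\<close> have expectations bounded uniformly in
  \<open>n\<close>, so by Fatou their lower limit is integrable and thus finite almost surely. The
  subsequence of scales and the bound \<open>D\<close> depend on the path.\<close>

lemma fBm_close_pairs_bounded_along_sequence:
  fixes W :: "real \<Rightarrow> 'a \<Rightarrow> real"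
  assumes B: "fractional_Brownian_motion h B" and h: "h < 1"
    and W: "\<And>t \<omega>. 0 \<le> t \<Longrightarrow> W t \<omega> = B t \<omega>"
    and meas[measurable]: "(\<lambda>(t, \<omega>). W t \<omega>) \<in> borel_measurable (borel \<Otimes>\<^sub>M M)"
    and I[measurable]: "I \<in> sets borel" and sub: "I \<subseteq> {0..1}"
  shows "AE \<omega> in M. \<exists>\<rho> D. (\<forall>n::nat. 0 < \<rho> n) \<and> \<rho> \<longlonglongrightarrow> 0 \<and> D < \<infinity> \<and>
    (\<forall>n. close_pairs (\<lambda>t. W t \<omega>) I (\<rho> n) \<le> ennreal (2 * \<rho> n) * D)"
proof -
  define p where "p n = 1 / real (Suc n)" for n
  have p: "0 < p n" for n by (simp add: p_def)
  define u where "u n \<omega> = ennreal (1 / (2 * p n)) * close_pairs (\<lambda>t. W t \<omega>) I (p n)" for n \<omega>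
  have [measurable]: "u n \<in> borel_measurable M" for n
    unfolding u_def close_pairs_def by measurable
  have u: "(\<integral>\<^sup>+ \<omega>. u n \<omega> \<partial>M) \<le> ennreal (4 / (1 - h))" for n
  proof -
    have "(\<integral>\<^sup>+ \<omega>. u n \<omega> \<partial>M) = ennreal (1 / (2 * p n)) * (\<integral>\<^sup>+ \<omega>. close_pairs (\<lambda>t. W t \<omega>) I (p n) \<partial>M)"
      unfolding u_def close_pairs_def by (rule nn_integral_cmult) measurable
    also have "\<dots> \<le> ennreal (1 / (2 * p n)) * (ennreal (2 * p n) * ennreal (4 / (1 - h)))"
      using fBm_expected_close_pairs[OF B h W meas I sub p] by (intro mult_left_mono) auto
    also have "\<dots> = ennreal (4 / (1 - h))"
      using p[of n] by (simp add: mult.assoc[symmetric] ennreal_mult[symmetric])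
    finally show ?thesis .
  qed
  have "(\<integral>\<^sup>+ \<omega>. liminf (\<lambda>n. u n \<omega>) \<partial>M) \<le> liminf (\<lambda>n. \<integral>\<^sup>+ \<omega>. u n \<omega> \<partial>M)"
    by (rule nn_integral_liminf) measurable
  also have "\<dots> \<le> liminf (\<lambda>n::nat. ennreal (4 / (1 - h)))"
    using u by (intro Liminf_mono always_eventually) auto
  also have "\<dots> < \<infinity>" by (simp add: Liminf_const)
  finally have "(\<integral>\<^sup>+ \<omega>. liminf (\<lambda>n. u n \<omega>) \<partial>M) \<noteq> \<infinity>" by simp
  then have "AE \<omega> in M. liminf (\<lambda>n. u n \<omega>) \<noteq> \<infinity>"
    by (intro nn_integral_PInf_AE) measurable
  then show ?thesis
  proof eventually_elim
    case (elim \<omega>)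
    then have "liminf (\<lambda>n. u n \<omega>) < \<infinity>" by (simp add: less_top)
    then obtain D and k :: "nat \<Rightarrow> nat" where D: "D < \<infinity>" "strict_mono k" "\<And>n. u (k n) \<omega> \<le> D"
      by (rule subseq_le_of_liminf_finite) blast
    have "p \<longlonglongrightarrow> 0" unfolding p_def by (rule LIMSEQ_Suc[OF lim_1_over_n])
    then have "(p \<circ> k) \<longlonglongrightarrow> 0" using D(2) by (rule LIMSEQ_subseq_LIMSEQ)
    moreover have "close_pairs (\<lambda>t. W t \<omega>) I ((p \<circ> k) n) \<le> ennreal (2 * (p \<circ> k) n) * D" for n
    proof -
      have "close_pairs (\<lambda>t. W t \<omega>) I (p (k n)) = ennreal (2 * p (k n)) * u (k n) \<omega>"
        using p[of "k n"] by (simp add: u_def mult.assoc[symmetric] ennreal_mult[symmetric])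
      also have "\<dots> \<le> ennreal (2 * p (k n)) * D" by (intro mult_left_mono D(3)) simp
      finally show ?thesis by simp
    qed
    ultimately show ?case using D(1) p by (intro exI[of _ "p \<circ> k"] exI[of _ D]) auto
  qed
qed

end

section \<open>Passage from fractional to grey Brownian motion\<close>

theorem theorem12:
  fixes M :: "'a measure" and X :: "real \<Rightarrow> 'a \<Rightarrow> real"
    and \<alpha> \<beta> :: real and I :: "real set"
  assumes "prob_space M"
    and "0 < \<alpha>" and "\<alpha> < 2"
    and "0 < \<beta>" and "\<beta> \<le> 1"
    and "prob_space.grey_Brownian_motion M \<alpha> \<beta> X"
    and "I \<in> sets borel" and "I \<subseteq> {0..1}"
  shows "admits_local_time M X I \<and>
    (AE \<omega> in M. (\<integral>\<^sup>+ x. (local_time X I \<omega> x)\<^sup>2 \<partial>lborel) < \<infinity>)"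
proof -
  interpret prob_space M by fact
  obtain Y B where Y: "M_Wright_variable \<beta> Y" and B: "fractional_Brownian_motion (\<alpha> / 2) B"
    and X: "\<And>t \<omega>. 0 \<le> t \<Longrightarrow> \<omega> \<in> space M \<Longrightarrow> X t \<omega> = sqrt (Y \<omega>) * B t \<omega>"
    using assms(6) unfolding grey_Brownian_motion_def by blast
  \<comment> \<open>Freezing \<open>B\<close> at its initial value for negative times makes the
    paths continuous on the whole line and leaves them unchanged on \<open>I\<close>.\<close>
  define W where "W t \<omega> = B (max t 0) \<omega>" for t \<omega>
  have rv: "random_variable borel (W t)" for t
    using B unfolding fractional_Brownian_motion_def gaussian_process_def W_def by simp
  have cont: "continuous_on UNIV (\<lambda>t. W t \<omega>)" if "\<omega> \<in> space M" for \<omega>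
  proof -
    have "continuous_on {0..} (\<lambda>t. B t \<omega>)"
      using B that unfolding fractional_Brownian_motion_def by blast
    then show ?thesis
      unfolding W_def by (rule continuous_on_compose2) (auto intro!: continuous_intros)
  qed
  have lt: "\<alpha> / 2 < 1" using assms(3) by simp
  have WB: "W t \<omega> = B t \<omega>" if "0 \<le> t" for t \<omega> using that by (simp add: W_def)
  have "emeasure lborel I \<le> emeasure lborel {0..1 :: real}"
    using assms(7,8) by (intro emeasure_mono) auto
  then have I_fin: "emeasure lborel I < \<infinity>" by (simp add: le_less_trans)
  have bounded: "AE \<omega> in M. \<exists>\<rho> D. (\<forall>n::nat. 0 < \<rho> n) \<and> \<rho> \<longlonglongrightarrow> 0 \<and> D < \<infinity> \<and>
      (\<forall>n. close_pairs (\<lambda>t. W t \<omega>) I (\<rho> n) \<le> ennreal (2 * \<rho> n) * D)"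
    using B lt WB jointly_measurable_of_continuous[OF rv cont] assms(7,8)
    by (rule fBm_close_pairs_bounded_along_sequence)
  have "AE \<omega> in M. has_occupation_density (\<lambda>t. X t \<omega>) I \<and>
      (\<integral>\<^sup>+ x. (occupation_density (\<lambda>t. X t \<omega>) I x)\<^sup>2 \<partial>lborel) < \<infinity>"
    using M_Wright_variable_pos[OF Y assms(4)] AE_space bounded
  proof eventually_elim
    case (elim \<omega>)
    then obtain \<rho> :: "nat \<Rightarrow> real" and D where \<rho>: "\<And>n. 0 < \<rho> n" "\<rho> \<longlonglongrightarrow> 0" "D < \<infinity>"
      "\<And>n. close_pairs (\<lambda>t. W t \<omega>) I (\<rho> n) \<le> ennreal (2 * \<rho> n) * D"
      by blast
    have "(\<lambda>t. W t \<omega>) \<in> borel_measurable borel"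
      using cont[OF elim(2)] by (rule borel_measurable_continuous_onI)
    moreover have "X t \<omega> = sqrt (Y \<omega>) * W t \<omega>" if "t \<in> I" for t
      using that assms(8) X[OF _ elim(2)] WB by auto
    \<comment> \<open>For fixed \<omega> the grey path is the path of \<open>W\<close> scaled by the
      constant \<open>sqrt (Y \<omega>)\<close>, which is positive almost surely.\<close>
    ultimately show ?case
      using occupation_density_of_close_pairs[OF assms(7) I_fin, of "\<lambda>t. W t \<omega>" "\<lambda>t. X t \<omega>" "sqrt (Y \<omega>)" \<rho> D]
        elim(1) \<rho> by simp
  qed
  then show ?thesis
    by (simp add: admits_local_time_def local_time_def AE_conj_iff)
qed

end
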